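(* Let $\mathbf p=(p_1,\dots,p_r)$ and $\mathbf q=(q_1,\dots,q_r)$ be probability distributions on $\mathcal X=\{c_1,\dots,c_r\}$ with $p_j>0$ and $q_j>0$ for all $j\in D$, and let $\alpha>0$, $\alpha\ne1$. Let $\widehat{\mathbf p}_n$ and $\widehat{\mathbf q}_m$ be the empirical distributions of i.i.d. samples $X_1,\dots,X_n$ from $\mathbf p$ and $Y_1,\dots,Y_m$ from $\mathbf q$. Put $A_{R,\alpha,1}^{(s)}=(A_{R,\alpha,1}+A_{R,\alpha,4})/2$ and $A_{R,\alpha,2}^{(s)}=(A_{R,\alpha,2}+A_{R,\alpha,3})/2$. Then: (a) (One sample) $$\limsup_{n\to+\infty}\frac{|\mathcal D_{R,\alpha}^{(s)}(\widehat{\mathbf p}_n,\mathbf q)-\mathcal D_{R,\alpha}^{(s)}(\mathbf p,\mathbf q)|}{a_n}\le A_{R,\alpha,1}^{(s)}\quad\text{a.s.},\qquad\limsup_{n\to+\infty}\frac{|\mathcal D_{R,\alpha}^{(s)}(\mathbf p,\widehat{\mathbf q}_n)-\mathcal D_{R,\alpha}^{(s)}(\mathbf p,\mathbf q)|}{b_n}\le A_{R,\alpha,2}^{(s)}\quad\text{a.s.}$$ (b) (Two samples) $$\limsup_{(n,m)\to(+\infty,+\infty)}\frac{|\mathcal D_{R,\alpha}^{(s)}(\widehat{\mathbf p}_n,\widehat{\mathbf q}_m)-\mathcal D_{R,\alpha}^{(s)}(\mathbf p,\mathbf q)|}{c_{n,m}}\le A_{R,\alpha,1}^{(s)}+A_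{R,\alpha,2}^{(s)}\quad\text{a.s.}$$
   Context: $\mathcal X=\{c_1,\dots,c_r\}$ with $r\ge 2$ is a finite set and $D=\{1,\dots,r\}$. A probability distribution $\mathbf p$ on $\mathcal X$ is identified with the vector $(p_1,\dots,p_r)$, $p_j$ being the mass of $c_j$. $X_1,X_2,\dots$ are i.i.d. with $\mathbb P(X_i=c_j)=p_j$, and $Y_1,Y_2,\dots$ are i.i.d. with $\mathbb P(Y_i=c_j)=q_j$; the two samples are independent of each other. Empirical probabilities: $\widehat p_n^{c_j}=\frac1n\sum_{i=1}^n 1_{\{X_i=c_j\}}$, $\widehat q_m^{c_j}=\frac1m\sum_{i=1}^m 1_{\{Y_i=c_j\}}$, $\widehat{\mathbf p}_n=(\widehat p_n^{c_j})_{j\in D}$, $\widehat{\mathbf q}_m=(\widehat q_m^{c_j})_{j\in D}$. $a_n=\sup_{j\in D}|\widehat p_n^{c_j}-p_j|$, $b_m=\sup_{j\in D}|\widehat q_m^{c_j}-q_j|$, $c_{n,m}=\max(a_n,b_m)$. $\mathcal S_\alpha(\mathbf p,\mathbf q)=\sum_{j\in D}p_j^\alpha q_j^{1-\alpha}$; Renyi-$\alpha$ divergence: $\mathcal D_{R,\alpha}(\mathbf p,\mathbf q)=\frac1{\alpha-1}\log\mathcal S_\alpha(\mathbf p,\mathbf q)$ (natural logarithm); symmetrized form: $\mathcal D_{R,\alpha}^{(s)}(\mathbf p,\mathbf q)=\frac12\bigl(\mathcal D_{R,\alpha}(\mathbf p,\mathbf q)+\mathcal D_{R,\alpha}(\mathbf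 q,\mathbf p)\bigr)$. $$A_{R,\alpha,1}=\frac{\frac{\alpha}{|\alpha-1|}\sum_{j\in D}(p_j/q_j)^{\alpha-1}}{\mathcal S_\alpha(\mathbf p,\mathbf q)},\quad A_{R,\alpha,2}=\frac{\sum_{j\in D}(p_j/q_j)^{\alpha}}{\mathcal S_\alpha(\mathbf p,\mathbf q)},$$ $$A_{R,\alpha,3}=\frac{\frac{\alpha}{|\alpha-1|}\sum_{j\in D}(q_j/p_j)^{\alpha-1}}{\mathcal S_\alpha(\mathbf p,\mathbf q)},\quad A_{R,\alpha,4}=\frac{\sum_{j\in D}(q_j/p_j)^{\alpha}}{\mathcal S_\alpha(\mathbf p,\mathbf q)}.$$
   Formalization: The constants A_{R,α,3} and A_{R,α,4} are taken with denominator S_α(q,p) instead of the printed S_α(p,q); as printed the bound fails, e.g. for α=2, p=(1/2,1/2), q=(1/100,99/100), where the first limsup is about 2.96 but the printed bound is about 2.08. *)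

theory Defs
  imports "HOL-Probability.Probability"
begin

text \<open>
  The alphabet is \<open>c ` {1..r}\<close> with \<open>c\<close> injective on \<open>{1..r}\<close>, so vectors indexed by \<open>{1..r}\<close> are
  functions \<open>nat \<Rightarrow> real\<close> whose values outside \<open>{1..r}\<close> are never used.
\<close>

definition prob_vector :: "nat \<Rightarrow> (nat \<Rightarrow> real) \<Rightarrow> bool" where
  "prob_vector r p \<longleftrightarrow> (\<forall>j\<in>{1..r}. 0 \<le> p j) \<and> (\<Sum>j\<in>{1..r}. p j) = 1"

definition iid_sample ::
  "'w measure \<Rightarrow> nat \<Rightarrow> (nat \<Rightarrow> 'a) \<Rightarrow> (nat \<Rightarrow> real) \<Rightarrow> (nat \<Rightarrow> 'w \<Rightarrow> 'a) \<Rightarrow> bool" where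
  "iid_sample M r c p X \<longleftrightarrow>
     prob_space.indep_vars M (\<lambda>_. count_space (c ` {1..r})) X {1..} \<and>
     (\<forall>i\<in>{1..}. \<forall>j\<in>{1..r}. measure M {\<omega>\<in>space M. X i \<omega> = c j} = p j)"

text \<open>Independence of the two whole sequences, viewed as random elements of the product space.\<close>

definition independent_samples ::
  "'w measure \<Rightarrow> nat \<Rightarrow> (nat \<Rightarrow> 'a) \<Rightarrow> (nat \<Rightarrow> 'w \<Rightarrow> 'a) \<Rightarrow> (nat \<Rightarrow> 'w \<Rightarrow> 'a) \<Rightarrow> bool" where
  "independent_samples M r c X Y \<longleftrightarrow>
     prob_space.indep_var M
       (\<Pi>\<^sub>M i\<in>{1..}. count_space (c ` {1..r})) (\<lambda>\<omega>. \<lambda>i\<in>{1..}. X i \<omega>)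
       (\<Pi>\<^sub>M i\<in>{1..}. count_space (c ` {1..r})) (\<lambda>\<omega>. \<lambda>i\<in>{1..}. Y i \<omega>)"

definition empirical :: "(nat \<Rightarrow> 'a) \<Rightarrow> (nat \<Rightarrow> 'w \<Rightarrow> 'a) \<Rightarrow> nat \<Rightarrow> 'w \<Rightarrow> nat \<Rightarrow> real" where
  "empirical c X n \<omega> j = (1 / real n) * (\<Sum>i = 1..n. indicator {c j} (X i \<omega>))"

definition sup_dev :: "nat \<Rightarrow> (nat \<Rightarrow> real) \<Rightarrow> (nat \<Rightarrow> real) \<Rightarrow> real" where
  "sup_dev r u v = (SUP j\<in>{1..r}. \<bar>u j - v j\<bar>)"

definition S_alpha :: "nat \<Rightarrow> real \<Rightarrow> (nat \<Rightarrow> real) \<Rightarrow> (nat \<Rightarrow> real) \<Rightarrow> real" where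
  "S_alpha r \<alpha> p q = (\<Sum>j\<in>{1..r}. p j powr \<alpha> * q j powr (1 - \<alpha>))"

text \<open>
  An empirical vector may have zero entries, and then the values below depend on the conventions
  \<open>0 powr a = 0\<close> and \<open>ln 0 = 0\<close>. When the true distributions are positive this almost surely happens
  only for finitely many sample sizes, so it does not affect upper limits.
\<close>

definition renyi_div :: "nat \<Rightarrow> real \<Rightarrow> (nat \<Rightarrow> real) \<Rightarrow> (nat \<Rightarrow> real) \<Rightarrow> real" where
  "renyi_div r \<alpha> p q = 1 / (\<alpha> - 1) * ln (S_alpha r \<alpha> p q)"

definition renyi_sym :: "nat \<Rightarrow> real \<Rightarrow> (nat \<Rightarrow> real) \<Rightarrow> (nat \<Rightarrow> real) \<Rightarrow> real" where
  "renyi_sym r \<alpha> p q = 1 / 2 * (renyi_div r \<alpha> p q + renyi_div r \<alpha> q p)"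

definition A1 :: "nat \<Rightarrow> real \<Rightarrow> (nat \<Rightarrow> real) \<Rightarrow> (nat \<Rightarrow> real) \<Rightarrow> real" where
  "A1 r \<alpha> p q = (\<alpha> / \<bar>\<alpha> - 1\<bar> * (\<Sum>j\<in>{1..r}. (p j / q j) powr (\<alpha> - 1))) / S_alpha r \<alpha> p q"

definition A2 :: "nat \<Rightarrow> real \<Rightarrow> (nat \<Rightarrow> real) \<Rightarrow> (nat \<Rightarrow> real) \<Rightarrow> real" where
  "A2 r \<alpha> p q = (\<Sum>j\<in>{1..r}. (p j / q j) powr \<alpha>) / S_alpha r \<alpha> p q"

text \<open>
  \<open>A3\<close> and \<open>A4\<close> bound the derivative of \<open>renyi_div r \<alpha> q p\<close>, the logarithm of \<open>S_alpha r \<alpha> q p\<close>, so they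
  are normalised by \<open>S_alpha r \<alpha> q p\<close>. The source prints \<open>S_alpha r \<alpha> p q\<close> here as well, a misprint that
  makes the one-sample bound false: for \<open>\<alpha> = 2\<close>, \<open>p = (1/2, 1/2)\<close>, \<open>q = (1/100, 99/100)\<close> the upper
  limit is about 2.96 almost surely, while \<open>(A1 + A4) / 2\<close> would be about 2.08 (it is 3 as defined here).
\<close>

definition A3 :: "nat \<Rightarrow> real \<Rightarrow> (nat \<Rightarrow> real) \<Rightarrow> (nat \<Rightarrow> real) \<Rightarrow> real" where
  "A3 r \<alpha> p q = (\<alpha> / \<bar>\<alpha> - 1\<bar> * (\<Sum>j\<in>{1..r}. (q j / p j) powr (\<alpha> - 1))) / S_alpha r \<alpha> q p"

definition A4 :: "nat \<Rightarrow> real \<Rightarrow> (nat \<Rightarrow> real) \<Rightarrow> (nat \<Rightarrow> real) \<Rightarrow> real" where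
  "A4 r \<alpha> p q = (\<Sum>j\<in>{1..r}. (q j / p j) powr \<alpha>) / S_alpha r \<alpha> q p"

definition A1_sym :: "nat \<Rightarrow> real \<Rightarrow> (nat \<Rightarrow> real) \<Rightarrow> (nat \<Rightarrow> real) \<Rightarrow> real" where
  "A1_sym r \<alpha> p q = (A1 r \<alpha> p q + A4 r \<alpha> p q) / 2"

definition A2_sym :: "nat \<Rightarrow> real \<Rightarrow> (nat \<Rightarrow> real) \<Rightarrow> (nat \<Rightarrow> real) \<Rightarrow> real" where
  "A2_sym r \<alpha> p q = (A2 r \<alpha> p q + A3 r \<alpha> p q) / 2"

end

theory Submission
  imports Defs
begin

text \<open>
  By Hoeffding's inequality and the Borel--Cantelli lemma, the empirical vectors converge almost
  surely to the true ones. On that event, apply the mean value theorem along the segment from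
  \<open>(p, q)\<close> to the empirical pair: the derivative of the symmetrized divergence is bounded by the sup
  deviations times \<open>A1_sym\<close> and \<open>A2_sym\<close> at an intermediate point. These depend continuously on the
  point, and the intermediate point tends to \<open>(p, q)\<close>.
\<close>

section \<open>A strong law for bounded independent variables\<close>

text \<open>Hoeffding bounds the probability of a deviation of size \<delta> by a term geometric in
  \<open>n\<close>. These bounds are summable, so Borel-Cantelli confines the deviations to finitely
  many \<open>n\<close> almost surely. Letting \<delta> shrink along a countable sequence gives
  convergence.\<close>

lemma (in prob_space) strong_law_bounded:
  fixes Z :: "nat \<Rightarrow> 'a \<Rightarrow> real"
  assumes indep: "indep_vars (\<lambda>_. borel) Z {1..}"
    and bounded: "\<And>i. i \<in> {1..} \<Longrightarrow> AE \<omega> in M. Z i \<omega> \<in> {a..b}"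
    and mean: "\<And>i. i \<in> {1..} \<Longrightarrow> expectation (Z i) = \<mu>"
    and "a < b"
  shows "AE \<omega> in M. (\<lambda>n. (1 / real n) * (\<Sum>i = 1..n. Z i \<omega>)) \<longlonglongrightarrow> \<mu>"
proof -
  have meas: "random_variable borel (Z i)" if "i \<in> {1..}" for i
    using indep that unfolding indep_vars_def by blast
  have dev: "AE \<omega> in M. eventually (\<lambda>n. \<bar>(1 / real n) * (\<Sum>i = 1..n. Z i \<omega>) - \<mu>\<bar> < \<delta>) sequentially"
    if "\<delta> > 0" for \<delta>
  proof -
    define A where "A n = {\<omega> \<in> space M. \<bar>(\<Sum>i = 1..n. Z i \<omega>) - n * \<mu>\<bar> \<ge> n * \<delta>}" for n
    have A_meas: "A n \<in> sets M" for n
    proof -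
      have [measurable]: "random_variable borel (\<lambda>\<omega>. \<Sum>i = 1..n. Z i \<omega>)"
        by (intro borel_measurable_sum meas) simp
      show ?thesis
        unfolding A_def by measurable
    qed
    \<comment> \<open>For \<open>n\<close> intervals of length \<open>b - a\<close> and a deviation
      \<open>n * \<delta>\<close> of the sum, Hoeffding's exponent is linear in \<open>n\<close>;
      \<open>k\<close> is the exponential of its slope, so the tail bound is
      \<open>2 * k ^ n\<close>.\<close>
    define k where "k = exp (- (2 * \<delta>\<^sup>2 / (b - a)\<^sup>2))"
    have k: "0 \<le> k" "k < 1"
      using that \<open>a < b\<close> by (auto simp: k_def)
    have prob_A: "prob (A n) \<le> 2 * k ^ n" if n: "n \<ge> 1" for n
    proof -
      interpret Hoeffding_ineq M "{1..n}" Z "\<lambda>_. a" "\<lambda>_. b" "\<Sum>i\<in>{1..n}. expectation (Z i)"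
        proof unfold_locales
        show "AE \<omega> in M. Z i \<omega> \<in> {a..b}" if "i \<in> {1..n}" for i
          using that by (intro bounded) simp
      qed (simp_all add: indep_vars_subset[OF indep])
      have "prob {\<omega> \<in> space M. \<bar>(\<Sum>i = 1..n. Z i \<omega>) - (\<Sum>i\<in>{1..n}. expectation (Z i))\<bar> \<ge> n * \<delta>}
             \<le> 2 * exp (-2 * (n * \<delta>)\<^sup>2 / (\<Sum>i\<in>{1..n}. (b - a)\<^sup>2))"
        using \<open>\<delta> > 0\<close> \<open>a < b\<close> n by (intro Hoeffding_ineq_abs_ge) auto
      also have "(\<Sum>i\<in>{1..n}. expectation (Z i)) = n * \<mu>"
        using mean by simp
      also have "-2 * (n * \<delta>)\<^sup>2 / (\<Sum>i\<in>{1..n}. (b - a)\<^sup>2) = real n * (- (2 * \<delta>\<^sup>2 / (b - a)\<^sup>2))"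
        using n by (simp add: power2_eq_square)
      also have "exp \<dots> = k ^ n"
        by (simp only: k_def exp_of_nat_mult)
      finally show ?thesis
        by (simp add: A_def)
    qed
    have "summable (\<lambda>n. prob (A n))"
    proof (rule summable_comparison_test_ev)
      show "eventually (\<lambda>n. norm (prob (A n)) \<le> 2 * k ^ n) sequentially"
        using eventually_ge_at_top[of 1] by eventually_elim (use prob_A in auto)
      show "summable (\<lambda>n. 2 * k ^ n)"
        using k by (intro summable_mult summable_geometric) auto
    qed
    then have "AE \<omega> in M. eventually (\<lambda>n. \<omega> \<in> space M - A n) sequentially"
      by (intro borel_cantelli_AE1 A_meas) (auto simp: emeasure_eq_measure)
    then show ?thesis
    proof eventually_elim
      case (elim \<omega>)
      from elim eventually_ge_at_top[of 1] show ?case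
      proof eventually_elim
        case (elim n)
        then have "\<bar>(\<Sum>i = 1..n. Z i \<omega>) - n * \<mu>\<bar> < n * \<delta>"
          by (auto simp: A_def)
        then have "\<bar>(\<Sum>i = 1..n. Z i \<omega>) - n * \<mu>\<bar> / n < \<delta>"
          using elim by (simp add: field_simps)
        also have "\<bar>(\<Sum>i = 1..n. Z i \<omega>) - n * \<mu>\<bar> / n = \<bar>((\<Sum>i = 1..n. Z i \<omega>) - n * \<mu>) / n\<bar>"
          by simp
        also have "((\<Sum>i = 1..n. Z i \<omega>) - n * \<mu>) / n = (1 / real n) * (\<Sum>i = 1..n. Z i \<omega>) - \<mu>"
          using elim by (simp add: field_simps)
        finally show ?case .
      qed
    qed
  qed
  \<comment> \<open>The exceptional null set in \<open>dev\<close> depends on \<delta>. Restricting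
    \<delta> to the values \<open>1 / (k + 1)\<close> leaves countably many null sets, whose union
    is null.\<close>
  have "AE \<omega> in M. \<forall>k. eventually (\<lambda>n. \<bar>(1 / real n) * (\<Sum>i = 1..n. Z i \<omega>) - \<mu>\<bar>
          < inverse (real (Suc k))) sequentially"
    unfolding AE_all_countable by (intro allI dev) auto
  then show ?thesis
  proof eventually_elim
    case (elim \<omega>)
    show ?case
    proof (rule tendstoI)
      fix e :: real assume "e > 0"
      then obtain k where k: "inverse (real (Suc k)) < e"
        using reals_Archimedean by blast
      from elim[rule_format, of k]
      show "eventually (\<lambda>n. dist ((1 / real n) * (\<Sum>i = 1..n. Z i \<omega>)) \<mu> < e) sequentially"
        by eventually_elim (use k in \<open>auto simp: dist_real_def\<close>)
    qed
  qed
qed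

text \<open>The frequency of a letter is the average of its indicators, which are independent, lie
  in [0,1] and have mean \<open>p j\<close>. The alphabet is finite, so one null set serves all
  letters.\<close>

lemma (in prob_space) empirical_tendsto:
  assumes "iid_sample M r c p X"
  shows "AE \<omega> in M. \<forall>j\<in>{1..r}. (\<lambda>n. empirical c X n \<omega> j) \<longlonglongrightarrow> p j"
proof (rule AE_ball_countable')
  show "countable {1..r}" by simp
  fix j assume j: "j \<in> {1..r}"
  from assms have indep: "indep_vars (\<lambda>_. count_space (c ` {1..r})) X {1..}"
    and prob: "\<And>i. i \<in> {1..} \<Longrightarrow> prob {\<omega> \<in> space M. X i \<omega> = c j} = p j"
    using j by (auto simp: iid_sample_def)
  define Z :: "nat \<Rightarrow> _ \<Rightarrow> real" where "Z i \<omega> = indicator {c j} (X i \<omega>)" for i \<omega>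
  have "indep_vars (\<lambda>_. borel) (\<lambda>i \<omega>. indicator {c j} (X i \<omega>) :: real) {1..}"
    by (rule indep_vars_compose2[OF indep]) simp
  then have Z: "indep_vars (\<lambda>_. borel) Z {1..}"
    by (simp add: Z_def[abs_def])
  have mean: "expectation (Z i) = p j" if i: "i \<in> {1..}" for i
  proof -
    have [measurable]: "X i \<in> measurable M (count_space (c ` {1..r}))"
      using indep i unfolding indep_vars_def by blast
    have ev: "{\<omega> \<in> space M. X i \<omega> = c j} \<in> events"
      by measurable
    have "expectation (Z i) = expectation (indicator {\<omega> \<in> space M. X i \<omega> = c j})"
      by (intro Bochner_Integration.integral_cong) (auto simp: Z_def indicator_def)
    then show ?thesis
      using ev prob[OF i] by simp
  qed
  have "AE \<omega> in M. (\<lambda>n. (1 / real n) * (\<Sum>i = 1..n. Z i \<omega>)) \<longlonglongrightarrow> p j"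
  proof (rule strong_law_bounded[OF Z])
    show "AE \<omega> in M. Z i \<omega> \<in> {0..1}" for i
      by (simp add: Z_def indicator_def)
  qed (simp_all add: mean)
  then show "AE \<omega> in M. (\<lambda>n. empirical c X n \<omega> j) \<longlonglongrightarrow> p j"
    by (simp add: empirical_def Z_def)
qed

section \<open>Derivative bounds for the divergence\<close>

lemma sup_dev_upper:
  assumes "j \<in> {1..r}"
  shows "\<bar>u j - v j\<bar> \<le> sup_dev r u v"
  unfolding sup_dev_def using assms by (intro cSUP_upper) auto

lemma sup_dev_nonneg:
  assumes "1 \<le> r"
  shows "0 \<le> sup_dev r u v"
  using sup_dev_upper[of 1 r u v] assms by auto

lemma sup_dev_self:
  assumes "1 \<le> r"
  shows "sup_dev r u u = 0"
  using assms by (simp add: sup_dev_def)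

lemma S_alpha_pos:
  assumes "1 \<le> r" "\<And>j. j \<in> {1..r} \<Longrightarrow> 0 < p j" "\<And>j. j \<in> {1..r} \<Longrightarrow> 0 < q j"
  shows "0 < S_alpha r \<alpha> p q"
  unfolding S_alpha_def using assms
  by (intro sum_pos mult_pos_pos) (auto simp: powr_gt_zero less_imp_neq[symmetric])

lemma S_alpha_nonneg: "0 \<le> S_alpha r \<alpha> p q"
  unfolding S_alpha_def by (intro sum_nonneg) auto

text \<open>Normalising \<open>A3\<close> and \<open>A4\<close> by
  \<open>S_alpha r \<alpha> q p\<close> makes them \<open>A1\<close> and \<open>A2\<close> with the
  arguments exchanged. One derivative bound then serves both halves of the symmetrized
  divergence.\<close>

lemma A3_eq: "A3 r \<alpha> p q = A1 r \<alpha> q p"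
  by (simp add: A1_def A3_def)

lemma A4_eq: "A4 r \<alpha> p q = A2 r \<alpha> q p"
  by (simp add: A2_def A4_def)

text \<open>Values of \<open>powr\<close> are nonnegative at every base, so the vectors are
  arbitrary. This generality matters in the limit argument, where the intermediate points are known
  to be positive only eventually.\<close>

lemma A1_nonneg: "0 < \<alpha> \<Longrightarrow> 0 \<le> A1 r \<alpha> p q"
  unfolding A1_def
  by (intro divide_nonneg_nonneg mult_nonneg_nonneg sum_nonneg S_alpha_nonneg) auto

lemma A2_nonneg: "0 \<le> A2 r \<alpha> p q"
  unfolding A2_def by (intro divide_nonneg_nonneg sum_nonneg S_alpha_nonneg) auto

text \<open>By the chain rule the derivative is linear in the velocities \<open>x'\<close> and
  \<open>y'\<close>, with the scaled partial derivatives of the logarithm of \<open>S_alpha\<close>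
  as coefficients. Summing their absolute values over the coordinates yields \<open>A1\<close> and
  \<open>A2\<close>.\<close>

lemma renyi_div_derivative_bound:
  fixes x y :: "real \<Rightarrow> nat \<Rightarrow> real"
  assumes "1 \<le> r" and \<alpha>: "0 < \<alpha>" "\<alpha> \<noteq> 1"
    and pos: "\<And>j. j \<in> {1..r} \<Longrightarrow> 0 < x s j" "\<And>j. j \<in> {1..r} \<Longrightarrow> 0 < y s j"
    and x: "\<And>j. j \<in> {1..r} \<Longrightarrow> ((\<lambda>t. x t j) has_real_derivative x' j) (at s)"
    and y: "\<And>j. j \<in> {1..r} \<Longrightarrow> ((\<lambda>t. y t j) has_real_derivative y' j) (at s)"
    and x': "\<And>j. j \<in> {1..r} \<Longrightarrow> \<bar>x' j\<bar> \<le> a" and y': "\<And>j. j \<in> {1..r} \<Longrightarrow> \<bar>y' j\<bar> \<le> b"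
  shows "\<exists>d. ((\<lambda>t. renyi_div r \<alpha> (x t) (y t)) has_real_derivative d) (at s) \<and>
             \<bar>d\<bar> \<le> a * A1 r \<alpha> (x s) (y s) + b * A2 r \<alpha> (x s) (y s)"
proof -
  define S where "S = S_alpha r \<alpha> (x s) (y s)"
  \<comment> \<open>\<open>g j\<close> and \<open>h j\<close> are the partial derivatives of
    \<open>S_alpha\<close> in the \<open>j\<close>-th entries of its first and second vector,
    written through the ratio of the two entries.\<close>
  define g where "g j = \<alpha> * (x s j / y s j) powr (\<alpha> - 1)" for j
  define h where "h j = (1 - \<alpha>) * (x s j / y s j) powr \<alpha>" for j
  have S: "S > 0"
    unfolding S_def using assms by (intro S_alpha_pos) auto
  have summand: "((\<lambda>t. x t j powr \<alpha> * y t j powr (1 - \<alpha>)) has_real_derivative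
               g j * x' j + h j * y' j) (at s)" if j: "j \<in> {1..r}" for j
  proof -
    have "((\<lambda>t. x t j powr \<alpha> * y t j powr (1 - \<alpha>)) has_real_derivative
            (\<alpha> * x s j powr (\<alpha> - 1) * x' j) * y s j powr (1 - \<alpha>)
             + ((1 - \<alpha>) * y s j powr (1 - \<alpha> - 1) * y' j) * x s j powr \<alpha>) (at s)"
      using DERIV_mult[OF DERIV_fun_powr[OF x[OF j] pos(1)[OF j]]
          DERIV_fun_powr[OF y[OF j] pos(2)[OF j]], of \<alpha> "1 - \<alpha>"] by simp
    also have "(\<alpha> * x s j powr (\<alpha> - 1) * x' j) * y s j powr (1 - \<alpha>)
             + ((1 - \<alpha>) * y s j powr (1 - \<alpha> - 1) * y' j) * x s j powr \<alpha> = g j * x' j + h j * y' j"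
      using pos[OF j]
      by (simp add: g_def h_def powr_divide powr_diff powr_minus field_simps)
    finally show ?thesis .
  qed
  have deriv: "((\<lambda>t. renyi_div r \<alpha> (x t) (y t)) has_real_derivative
      1 / (\<alpha> - 1) * ((\<Sum>j\<in>{1..r}. g j * x' j + h j * y' j) / S)) (at s)"
  proof -
    have "((\<lambda>t. S_alpha r \<alpha> (x t) (y t)) has_real_derivative
        (\<Sum>j\<in>{1..r}. g j * x' j + h j * y' j)) (at s)"
      unfolding S_alpha_def by (rule DERIV_sum) (rule summand)
    then have "((\<lambda>t. ln (S_alpha r \<alpha> (x t) (y t))) has_real_derivative
        1 / S_alpha r \<alpha> (x s) (y s) * (\<Sum>j\<in>{1..r}. g j * x' j + h j * y' j)) (at s)"
      by (rule DERIV_chain2[OF DERIV_ln_divide, rotated]) (use S in \<open>simp add: S_def\<close>)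
    from DERIV_cmult[OF this, of "1 / (\<alpha> - 1)"] show ?thesis
      unfolding renyi_div_def S_def by simp
  qed
  have "\<bar>\<Sum>j\<in>{1..r}. g j * x' j + h j * y' j\<bar> \<le> (\<Sum>j\<in>{1..r}. \<bar>g j\<bar> * a + \<bar>h j\<bar> * b)"
  proof (rule order_trans[OF sum_abs], rule sum_mono)
    fix j assume j: "j \<in> {1..r}"
    have "\<bar>g j * x' j + h j * y' j\<bar> \<le> \<bar>g j\<bar> * \<bar>x' j\<bar> + \<bar>h j\<bar> * \<bar>y' j\<bar>"
      by (metis abs_mult abs_triangle_ineq)
    also have "\<dots> \<le> \<bar>g j\<bar> * a + \<bar>h j\<bar> * b"
      using x'[OF j] y'[OF j] by (intro add_mono mult_left_mono) auto
    finally show "\<bar>g j * x' j + h j * y' j\<bar> \<le> \<bar>g j\<bar> * a + \<bar>h j\<bar> * b" .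
  qed
  also have "\<dots> = a * (\<Sum>j\<in>{1..r}. \<bar>g j\<bar>) + b * (\<Sum>j\<in>{1..r}. \<bar>h j\<bar>)"
    by (simp add: sum.distrib sum_distrib_left mult.commute)
  finally have num: "\<bar>\<Sum>j\<in>{1..r}. g j * x' j + h j * y' j\<bar>
      \<le> a * (\<Sum>j\<in>{1..r}. \<bar>g j\<bar>) + b * (\<Sum>j\<in>{1..r}. \<bar>h j\<bar>)" .
  \<comment> \<open>The prefactor \<open>1 / (\<alpha> - 1)\<close> of the divergence leaves
    \<alpha> / |\<alpha> - 1| in \<open>A1\<close>. In \<open>A2\<close> it cancels against the
    factor \<open>1 - \<alpha>\<close> of \<open>h\<close>, so no prefactor remains there.\<close>
  have A1: "A1 r \<alpha> (x s) (y s) = (\<Sum>j\<in>{1..r}. \<bar>g j\<bar>) / (\<bar>\<alpha> - 1\<bar> * S)"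
    using \<alpha> by (simp add: A1_def g_def S_def abs_mult sum_distrib_left[symmetric])
  have A2: "A2 r \<alpha> (x s) (y s) = (\<Sum>j\<in>{1..r}. \<bar>h j\<bar>) / (\<bar>\<alpha> - 1\<bar> * S)"
    using \<alpha> by (simp add: A2_def h_def S_def abs_mult sum_distrib_left[symmetric] abs_minus_commute)
  have "\<bar>1 / (\<alpha> - 1) * ((\<Sum>j\<in>{1..r}. g j * x' j + h j * y' j) / S)\<bar>
      = \<bar>\<Sum>j\<in>{1..r}. g j * x' j + h j * y' j\<bar> / (\<bar>\<alpha> - 1\<bar> * S)"
    using S by (simp add: abs_mult)
  also have "\<dots> \<le> (a * (\<Sum>j\<in>{1..r}. \<bar>g j\<bar>) + b * (\<Sum>j\<in>{1..r}. \<bar>h j\<bar>)) / (\<bar>\<alpha> - 1\<bar> * S)"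
    using num S by (intro divide_right_mono) auto
  also have "\<dots> = a * A1 r \<alpha> (x s) (y s) + b * A2 r \<alpha> (x s) (y s)"
    by (simp add: A1 A2 add_divide_distrib)
  finally show ?thesis
    using deriv by blast
qed

text \<open>The mean value theorem is applied to the whole symmetrized divergence along one joint
  segment, so both constants are taken at the same intermediate point. About this point only its
  entrywise distance from \<open>p\<close> and \<open>q\<close> is recorded, which suffices for
  convergence.\<close>

lemma renyi_sym_mean_value_bound:
  fixes p q u v :: "nat \<Rightarrow> real"
  assumes "1 \<le> r" and \<alpha>: "0 < \<alpha>" "\<alpha> \<noteq> 1"
    and pos: "\<And>j. j \<in> {1..r} \<Longrightarrow> 0 < p j" "\<And>j. j \<in> {1..r} \<Longrightarrow> 0 < q j"
      "\<And>j. j \<in> {1..r} \<Longrightarrow> 0 < u j" "\<And>j. j \<in> {1..r} \<Longrightarrow> 0 < v j"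
  shows "\<exists>x y. (\<forall>j. \<bar>x j - p j\<bar> \<le> \<bar>u j - p j\<bar>) \<and> (\<forall>j. \<bar>y j - q j\<bar> \<le> \<bar>v j - q j\<bar>) \<and>
           \<bar>renyi_sym r \<alpha> u v - renyi_sym r \<alpha> p q\<bar>
             \<le> sup_dev r u p * A1_sym r \<alpha> x y + sup_dev r v q * A2_sym r \<alpha> x y"
proof -
  \<comment> \<open>The interpolation runs over all indices, also outside \<open>{1..r}\<close>, so
    that the endpoints equal \<open>p\<close>, \<open>q\<close>, \<open>u\<close>, \<open>v\<close>
    as functions.\<close>
  define x where "x t j = p j + t * (u j - p j)" for t :: real and j
  define y where "y t j = q j + t * (v j - q j)" for t :: real and j
  define a where "a = sup_dev r u p"
  define b where "b = sup_dev r v q"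
  have segment_pos: "0 < m + t * (n - m)" if "0 < m" "0 < n" "0 \<le> t" "t \<le> 1" for m n t :: real
  proof -
    have "m + t * (n - m) = (1 - t) * m + t * n"
      by (simp add: algebra_simps)
    also have "\<dots> > 0"
      using that by (cases "t = 0") (auto intro: add_nonneg_pos)
    finally show ?thesis .
  qed
  have bound: "\<exists>d. ((\<lambda>t. renyi_sym r \<alpha> (x t) (y t)) has_real_derivative d) (at s) \<and>
           \<bar>d\<bar> \<le> a * A1_sym r \<alpha> (x s) (y s) + b * A2_sym r \<alpha> (x s) (y s)"
    if s: "0 \<le> s" "s \<le> 1" for s
  proof -
    have xpos: "0 < x s j" and ypos: "0 < y s j" if "j \<in> {1..r}" for j
      unfolding x_def y_def using segment_pos s pos[OF that] by blast+
    have dx: "((\<lambda>t. x t j) has_real_derivative u j - p j) (at s)"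
      and dy: "((\<lambda>t. y t j) has_real_derivative v j - q j) (at s)" for j
      unfolding x_def y_def by (auto intro!: derivative_eq_intros)
    have du: "\<bar>u j - p j\<bar> \<le> a" and dv: "\<bar>v j - q j\<bar> \<le> b" if "j \<in> {1..r}" for j
      unfolding a_def b_def using that by (auto intro!: sup_dev_upper)
    obtain d where d: "((\<lambda>t. renyi_div r \<alpha> (x t) (y t)) has_real_derivative d) (at s)"
      "\<bar>d\<bar> \<le> a * A1 r \<alpha> (x s) (y s) + b * A2 r \<alpha> (x s) (y s)"
      using renyi_div_derivative_bound[of r \<alpha> x s y, OF assms(1) \<alpha> xpos ypos dx dy du dv] by blast
    \<comment> \<open>In the reversed divergence the weights change places: \<open>a\<close> now
      multiplies \<open>A2 r \<alpha> (y s) (x s)\<close>, which is \<open>A4\<close>, and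
      \<open>b\<close> multiplies \<open>A3\<close>. Hence the pairing of \<open>A1\<close> with
      \<open>A4\<close> and of \<open>A2\<close> with \<open>A3\<close>.\<close>
    obtain e where e: "((\<lambda>t. renyi_div r \<alpha> (y t) (x t)) has_real_derivative e) (at s)"
      "\<bar>e\<bar> \<le> b * A1 r \<alpha> (y s) (x s) + a * A2 r \<alpha> (y s) (x s)"
      using renyi_div_derivative_bound[of r \<alpha> y s x, OF assms(1) \<alpha> ypos xpos dy dx dv du] by blast
    have "((\<lambda>t. renyi_sym r \<alpha> (x t) (y t)) has_real_derivative 1 / 2 * (d + e)) (at s)"
      unfolding renyi_sym_def by (intro DERIV_cmult DERIV_add d e)
    moreover have "\<bar>1 / 2 * (d + e)\<bar> \<le> a * A1_sym r \<alpha> (x s) (y s) + b * A2_sym r \<alpha> (x s) (y s)"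
    proof -
      have "\<bar>1 / 2 * (d + e)\<bar> \<le> (\<bar>d\<bar> + \<bar>e\<bar>) / 2"
        by simp
      also have "\<dots> \<le> ((a * A1 r \<alpha> (x s) (y s) + b * A2 r \<alpha> (x s) (y s))
          + (b * A1 r \<alpha> (y s) (x s) + a * A2 r \<alpha> (y s) (x s))) / 2"
        using d(2) e(2) by simp
      also have "\<dots> = a * A1_sym r \<alpha> (x s) (y s) + b * A2_sym r \<alpha> (x s) (y s)"
        by (simp add: A1_sym_def A2_sym_def A3_eq A4_eq field_simps)
      finally show ?thesis .
    qed
    ultimately show ?thesis by blast
  qed
  \<comment> \<open>\<open>MVT2\<close> takes the derivative as a function of \<open>s\<close>, so a
    witness of \<open>bound\<close> is chosen at each point.\<close>
  define D where "D s = (SOME d. ((\<lambda>t. renyi_sym r \<alpha> (x t) (y t)) has_real_derivative d) (at s) \<and>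
           \<bar>d\<bar> \<le> a * A1_sym r \<alpha> (x s) (y s) + b * A2_sym r \<alpha> (x s) (y s))" for s
  have D: "((\<lambda>t. renyi_sym r \<alpha> (x t) (y t)) has_real_derivative D s) (at s)"
    "\<bar>D s\<bar> \<le> a * A1_sym r \<alpha> (x s) (y s) + b * A2_sym r \<alpha> (x s) (y s)"
    if "0 \<le> s" "s \<le> 1" for s
    using someI_ex[OF bound[OF that]] unfolding D_def by blast+
  obtain s where s: "0 < s" "s < 1"
    and mvt: "renyi_sym r \<alpha> (x 1) (y 1) - renyi_sym r \<alpha> (x 0) (y 0) = (1 - 0) * D s"
    using MVT2[of 0 1 "\<lambda>t. renyi_sym r \<alpha> (x t) (y t)" D] D(1) by auto
  have "x 1 = u" "y 1 = v" "x 0 = p" "y 0 = q"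
    by (simp_all add: x_def y_def fun_eq_iff)
  with mvt have "\<bar>renyi_sym r \<alpha> u v - renyi_sym r \<alpha> p q\<bar>
      \<le> a * A1_sym r \<alpha> (x s) (y s) + b * A2_sym r \<alpha> (x s) (y s)"
    using D(2)[of s] s by simp
  moreover have "\<bar>x s j - p j\<bar> \<le> \<bar>u j - p j\<bar>" "\<bar>y s j - q j\<bar> \<le> \<bar>v j - q j\<bar>" for j
    using s by (auto simp: x_def y_def abs_mult intro!: mult_left_le_one_le)
  ultimately show ?thesis
    unfolding a_def b_def by blast
qed

section \<open>Passing to the limit\<close>

text \<open>Both constants are continuous at positive vectors: the limits of all bases and
  denominators are nonzero, and that is enough even if some \<open>x i\<close> or \<open>y i\<close>
  have entries that are not positive.\<close>

lemma
  fixes x y :: "'i \<Rightarrow> nat \<Rightarrow> real"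
  assumes "1 \<le> r"
    and pos: "\<And>j. j \<in> {1..r} \<Longrightarrow> 0 < p j" "\<And>j. j \<in> {1..r} \<Longrightarrow> 0 < q j"
    and lim: "\<And>j. j \<in> {1..r} \<Longrightarrow> ((\<lambda>i. x i j) \<longlongrightarrow> p j) F"
      "\<And>j. j \<in> {1..r} \<Longrightarrow> ((\<lambda>i. y i j) \<longlongrightarrow> q j) F"
  shows tendsto_A1: "((\<lambda>i. A1 r \<alpha> (x i) (y i)) \<longlongrightarrow> A1 r \<alpha> p q) F"
    and tendsto_A2: "((\<lambda>i. A2 r \<alpha> (x i) (y i)) \<longlongrightarrow> A2 r \<alpha> p q) F"
proof -
  have nz: "p j \<noteq> 0" "q j \<noteq> 0" if "j \<in> {1..r}" for j
    using pos[OF that] by auto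
  have S: "((\<lambda>i. S_alpha r \<alpha> (x i) (y i)) \<longlongrightarrow> S_alpha r \<alpha> p q) F"
    unfolding S_alpha_def using nz by (intro tendsto_intros lim) auto
  have S_nz: "S_alpha r \<alpha> p q \<noteq> 0"
    using S_alpha_pos[of r p q \<alpha>] assms(1) pos by auto
  have ratio: "((\<lambda>i. (x i j / y i j) powr e) \<longlongrightarrow> (p j / q j) powr e) F" if j: "j \<in> {1..r}" for j e
    using nz[OF j] by (intro tendsto_powr tendsto_divide lim j tendsto_const) auto
  show "((\<lambda>i. A1 r \<alpha> (x i) (y i)) \<longlongrightarrow> A1 r \<alpha> p q) F"
    unfolding A1_def by (intro tendsto_divide tendsto_mult tendsto_sum ratio S S_nz tendsto_const)
  show "((\<lambda>i. A2 r \<alpha> (x i) (y i)) \<longlongrightarrow> A2 r \<alpha> p q) F"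
    unfolding A2_def by (intro tendsto_divide tendsto_sum ratio S S_nz)
qed

text \<open>The functions \<open>h\<close> and \<open>k\<close> are \<open>A1_sym\<close> and
  \<open>A2_sym\<close> at the intermediate points, which are squeezed towards \<open>p\<close> and
  \<open>q\<close>. The filter is arbitrary so that single sequences and pairs of sample sizes are
  covered alike.\<close>

lemma renyi_sym_asymptotic_bound:
  fixes u v :: "'i \<Rightarrow> nat \<Rightarrow> real"
  assumes "1 \<le> r" and \<alpha>: "0 < \<alpha>" "\<alpha> \<noteq> 1"
    and pos: "\<And>j. j \<in> {1..r} \<Longrightarrow> 0 < p j" "\<And>j. j \<in> {1..r} \<Longrightarrow> 0 < q j"
    and lim: "\<And>j. j \<in> {1..r} \<Longrightarrow> ((\<lambda>i. u i j) \<longlongrightarrow> p j) F"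
      "\<And>j. j \<in> {1..r} \<Longrightarrow> ((\<lambda>i. v i j) \<longlongrightarrow> q j) F"
  obtains h k where "(h \<longlongrightarrow> A1_sym r \<alpha> p q) F" "(k \<longlongrightarrow> A2_sym r \<alpha> p q) F"
    "\<And>i. 0 \<le> h i" "\<And>i. 0 \<le> k i"
    "\<forall>\<^sub>F i in F. \<bar>renyi_sym r \<alpha> (u i) (v i) - renyi_sym r \<alpha> p q\<bar>
        \<le> sup_dev r (u i) p * h i + sup_dev r (v i) q * k i"
proof -
  \<comment> \<open>Positivity is a premise inside \<open>B\<close>, so a witness exists at every
    index: where some entry is not positive, the pair \<open>p\<close>, \<open>q\<close> itself
    works. The chosen points then converge without restriction to a subset of indices.\<close>
  define B where "B i x y \<longleftrightarrow>
      (\<forall>j. \<bar>x j - p j\<bar> \<le> \<bar>u i j - p j\<bar>) \<and> (\<forall>j. \<bar>y j - q j\<bar> \<le> \<bar>v i j - q j\<bar>) \<and>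
      ((\<forall>j\<in>{1..r}. 0 < u i j \<and> 0 < v i j) \<longrightarrow>
         \<bar>renyi_sym r \<alpha> (u i) (v i) - renyi_sym r \<alpha> p q\<bar>
           \<le> sup_dev r (u i) p * A1_sym r \<alpha> x y + sup_dev r (v i) q * A2_sym r \<alpha> x y)" for i x y
  have "\<exists>x y. B i x y" for i
  proof (cases "\<forall>j\<in>{1..r}. 0 < u i j \<and> 0 < v i j")
    case True
    then show ?thesis
      unfolding B_def using renyi_sym_mean_value_bound[of r \<alpha> p q "u i" "v i"] assms(1) \<alpha> pos by blast
  next
    case False
    then have "B i p q"
      unfolding B_def by (intro conjI impI allI) (use False in \<open>simp_all only: diff_self abs_zero abs_ge_zero simp_thms\<close>)
    then show ?thesis by blast
  qed
  then obtain x y where B: "\<And>i. B i (x i) (y i)"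
    by metis
  have squeeze: "((\<lambda>i. f i) \<longlongrightarrow> l) F" if "(g \<longlongrightarrow> l) F" "\<And>i. \<bar>f i - l\<bar> \<le> \<bar>g i - l\<bar>"
    for f g :: "'i \<Rightarrow> real" and l
  proof -
    have "((\<lambda>i. g i - l) \<longlongrightarrow> 0) F"
      using that(1) by (simp add: LIM_zero_iff)
    then have "((\<lambda>i. f i - l) \<longlongrightarrow> 0) F"
      by (rule Lim_null_comparison[rotated, OF tendsto_rabs_zero]) (use that(2) in simp)
    then show ?thesis
      by (simp add: LIM_zero_iff)
  qed
  have xlim: "((\<lambda>i. x i j) \<longlongrightarrow> p j) F" and ylim: "((\<lambda>i. y i j) \<longlongrightarrow> q j) F"
    if "j \<in> {1..r}" for j
    using B by (auto intro: squeeze[OF lim(1)[OF that]] squeeze[OF lim(2)[OF that]] simp: B_def)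
  show thesis
  proof
    show "((\<lambda>i. A1_sym r \<alpha> (x i) (y i)) \<longlongrightarrow> A1_sym r \<alpha> p q) F"
      unfolding A1_sym_def A4_eq
      by (intro tendsto_divide tendsto_add tendsto_A1 tendsto_A2 assms(1) pos xlim ylim tendsto_const)
        auto
    show "((\<lambda>i. A2_sym r \<alpha> (x i) (y i)) \<longlongrightarrow> A2_sym r \<alpha> p q) F"
      unfolding A2_sym_def A3_eq
      by (intro tendsto_divide tendsto_add tendsto_A1 tendsto_A2 assms(1) pos xlim ylim tendsto_const)
        auto
    show "0 \<le> A1_sym r \<alpha> (x i) (y i)" "0 \<le> A2_sym r \<alpha> (x i) (y i)" for i
      using \<alpha> by (simp_all add: A1_sym_def A2_sym_def A3_eq A4_eq A1_nonneg A2_nonneg)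
    have "\<forall>\<^sub>F i in F. \<forall>j\<in>{1..r}. 0 < u i j \<and> 0 < v i j"
      by (intro eventually_ball_finite ballI eventually_conj finite_atLeastAtMost
          order_tendstoD(1)[OF lim(1)] order_tendstoD(1)[OF lim(2)] pos)
    then show "\<forall>\<^sub>F i in F. \<bar>renyi_sym r \<alpha> (u i) (v i) - renyi_sym r \<alpha> p q\<bar>
        \<le> sup_dev r (u i) p * A1_sym r \<alpha> (x i) (y i) + sup_dev r (v i) q * A2_sym r \<alpha> (x i) (y i)"
      by eventually_elim (use B in \<open>auto simp: B_def\<close>)
  qed
qed

text \<open>Eventually the quotient is at most \<open>g i\<close>. Where \<open>d i = 0\<close>, as
  happens when an empirical vector hits the true one exactly, the quotient is 0 by the convention
  for division, and the nonnegativity of \<open>g\<close> covers this case.\<close>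

lemma Limsup_quotient_le:
  fixes f d g :: "'i \<Rightarrow> real"
  assumes "F \<noteq> bot" and "(g \<longlongrightarrow> l) F" and "\<And>i. 0 \<le> g i" and "\<And>i. 0 \<le> d i"
    and "\<forall>\<^sub>F i in F. f i \<le> d i * g i"
  shows "Limsup F (\<lambda>i. ereal (f i / d i)) \<le> ereal l"
proof -
  have "\<forall>\<^sub>F i in F. ereal (f i / d i) \<le> ereal (g i)"
    using assms(5)
  proof eventually_elim
    case (elim i)
    then show ?case
      using assms(3)[of i] assms(4)[of i]
      by (cases "d i = 0") (auto simp: divide_le_eq mult.commute)
  qed
  then have "Limsup F (\<lambda>i. ereal (f i / d i)) \<le> Limsup F (\<lambda>i. ereal (g i))"
    by (rule Limsup_mono)
  also have "\<dots> = ereal l"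
    using assms(1,2) by (intro lim_imp_Limsup) auto
  finally show ?thesis .
qed

section \<open>The almost sure bounds for one and two samples\<close>

theorem corollary7:
  fixes M :: "'w measure" and r :: nat and c :: "nat \<Rightarrow> 'a"
    and p q :: "nat \<Rightarrow> real" and X Y :: "nat \<Rightarrow> 'w \<Rightarrow> 'a" and \<alpha> :: real
  assumes "prob_space M"
    and "2 \<le> r" and "inj_on c {1..r}"
    and "prob_vector r p" and "prob_vector r q"
    and "\<And>j. j \<in> {1..r} \<Longrightarrow> 0 < p j" and "\<And>j. j \<in> {1..r} \<Longrightarrow> 0 < q j"
    and "0 < \<alpha>" and "\<alpha> \<noteq> 1"
    and "iid_sample M r c p X" and "iid_sample M r c q Y"
    and "independent_samples M r c X Y"
  shows
    "(AE \<omega> in M.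
        limsup (\<lambda>n. ereal (\<bar>renyi_sym r \<alpha> (empirical c X n \<omega>) q - renyi_sym r \<alpha> p q\<bar>
                            / sup_dev r (empirical c X n \<omega>) p))
        \<le> ereal (A1_sym r \<alpha> p q)) \<and>
     (AE \<omega> in M.
        limsup (\<lambda>n. ereal (\<bar>renyi_sym r \<alpha> p (empirical c Y n \<omega>) - renyi_sym r \<alpha> p q\<bar>
                            / sup_dev r (empirical c Y n \<omega>) q))
        \<le> ereal (A2_sym r \<alpha> p q)) \<and>
     (AE \<omega> in M.
        Limsup (sequentially \<times>\<^sub>F sequentially)
          (\<lambda>(n, m). ereal (\<bar>renyi_sym r \<alpha> (empirical c X n \<omega>) (empirical c Y m \<omega>)
                              - renyi_sym r \<alpha> p q\<bar>
                            / max (sup_dev r (empirical c X n \<omega>) p)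
                                  (sup_dev r (empirical c Y m \<omega>) q)))
        \<le> ereal (A1_sym r \<alpha> p q + A2_sym r \<alpha> p q))"
proof -
  interpret prob_space M by fact
  have r: "1 \<le> r" using \<open>2 \<le> r\<close> by simp
  note bound = renyi_sym_asymptotic_bound[where r = r and p = p and q = q, OF r \<open>0 < \<alpha>\<close> \<open>\<alpha> \<noteq> 1\<close> assms(6,7)]
  have X: "AE \<omega> in M. \<forall>j\<in>{1..r}. (\<lambda>n. empirical c X n \<omega> j) \<longlonglongrightarrow> p j"
    using assms(10) by (rule empirical_tendsto)
  have Y: "AE \<omega> in M. \<forall>j\<in>{1..r}. (\<lambda>n. empirical c Y n \<omega> j) \<longlonglongrightarrow> q j"
    using assms(11) by (rule empirical_tendsto)
  show ?thesis
  proof (intro conjI)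
    show "AE \<omega> in M. limsup (\<lambda>n. ereal (\<bar>renyi_sym r \<alpha> (empirical c X n \<omega>) q - renyi_sym r \<alpha> p q\<bar>
                            / sup_dev r (empirical c X n \<omega>) p)) \<le> ereal (A1_sym r \<alpha> p q)"
      using X
    proof eventually_elim
      case (elim \<omega>)
      \<comment> \<open>The second vector is held constant at \<open>q\<close>. Its deviation
        \<open>sup_dev r q q\<close> is 0, so the term with \<open>k\<close> vanishes and only
        \<open>A1_sym\<close> survives.\<close>
      obtain h k where hk: "h \<longlonglongrightarrow> A1_sym r \<alpha> p q" "\<And>n. 0 \<le> h n"
        "\<forall>\<^sub>F n in sequentially. \<bar>renyi_sym r \<alpha> (empirical c X n \<omega>) q - renyi_sym r \<alpha> p q\<bar>
          \<le> sup_dev r (empirical c X n \<omega>) p * h n + sup_dev r q q * k n"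
        by (rule bound[where u = "\<lambda>n. empirical c X n \<omega>" and v = "\<lambda>_. q" and F = sequentially])
          (use elim in auto)
      show ?case
        by (rule Limsup_quotient_le[OF _ hk(1,2)]) (use hk(3) r in \<open>simp_all add: sup_dev_self sup_dev_nonneg\<close>)
    qed
    show "AE \<omega> in M. limsup (\<lambda>n. ereal (\<bar>renyi_sym r \<alpha> p (empirical c Y n \<omega>) - renyi_sym r \<alpha> p q\<bar>
                            / sup_dev r (empirical c Y n \<omega>) q)) \<le> ereal (A2_sym r \<alpha> p q)"
      using Y
    proof eventually_elim
      case (elim \<omega>)
      obtain h k where hk: "k \<longlonglongrightarrow> A2_sym r \<alpha> p q" "\<And>n. 0 \<le> k n"
        "\<forall>\<^sub>F n in sequentially. \<bar>renyi_sym r \<alpha> p (empirical c Y n \<omega>) - renyi_sym r \<alpha> p q\<bar>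
          \<le> sup_dev r p p * h n + sup_dev r (empirical c Y n \<omega>) q * k n"
        by (rule bound[where u = "\<lambda>_. p" and v = "\<lambda>n. empirical c Y n \<omega>" and F = sequentially])
          (use elim in auto)
      show ?case
        by (rule Limsup_quotient_le[OF _ hk(1,2)]) (use hk(3) r in \<open>simp_all add: sup_dev_self sup_dev_nonneg\<close>)
    qed
    show "AE \<omega> in M. Limsup (sequentially \<times>\<^sub>F sequentially)
          (\<lambda>(n, m). ereal (\<bar>renyi_sym r \<alpha> (empirical c X n \<omega>) (empirical c Y m \<omega>)
                              - renyi_sym r \<alpha> p q\<bar>
                            / max (sup_dev r (empirical c X n \<omega>) p)
                                  (sup_dev r (empirical c Y m \<omega>) q)))
        \<le> ereal (A1_sym r \<alpha> p q + A2_sym r \<alpha> p q)"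
      using X Y
    proof eventually_elim
      case (elim \<omega>)
      \<comment> \<open>On the intersection of the two almost sure events the argument is
        deterministic. It is indexed by pairs of sample sizes, and each empirical vector converges
        through a projection of the product filter.\<close>
      define u where "u i = empirical c X (fst i) \<omega>" for i :: "nat \<times> nat"
      define v where "v i = empirical c Y (snd i) \<omega>" for i :: "nat \<times> nat"
      define d where "d i = max (sup_dev r (u i) p) (sup_dev r (v i) q)" for i
      have ulim: "((\<lambda>i. u i j) \<longlongrightarrow> p j) (sequentially \<times>\<^sub>F sequentially)" if "j \<in> {1..r}" for j
        unfolding u_def using elim that by (intro filterlim_compose[OF _ filterlim_fst]) auto
      have vlim: "((\<lambda>i. v i j) \<longlongrightarrow> q j) (sequentially \<times>\<^sub>F sequentially)" if "j \<in> {1..r}" for j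
        unfolding v_def using elim that by (intro filterlim_compose[OF _ filterlim_snd]) auto
      obtain h k where hk: "(h \<longlongrightarrow> A1_sym r \<alpha> p q) (sequentially \<times>\<^sub>F sequentially)"
        "(k \<longlongrightarrow> A2_sym r \<alpha> p q) (sequentially \<times>\<^sub>F sequentially)" "\<And>i. 0 \<le> h i" "\<And>i. 0 \<le> k i"
        and le: "\<forall>\<^sub>F i in sequentially \<times>\<^sub>F sequentially.
          \<bar>renyi_sym r \<alpha> (u i) (v i) - renyi_sym r \<alpha> p q\<bar>
          \<le> sup_dev r (u i) p * h i + sup_dev r (v i) q * k i"
        by (rule bound[where u = u and v = v and F = "sequentially \<times>\<^sub>F sequentially"],
            assumption, assumption, erule ulim, erule vlim, rule that)
      have "Limsup (sequentially \<times>\<^sub>F sequentially)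
          (\<lambda>i. ereal (\<bar>renyi_sym r \<alpha> (u i) (v i) - renyi_sym r \<alpha> p q\<bar> / d i))
        \<le> ereal (A1_sym r \<alpha> p q + A2_sym r \<alpha> p q)"
      proof (rule Limsup_quotient_le[OF _ tendsto_add[OF hk(1,2)]])
        \<comment> \<open>Both deviations are at most their maximum \<open>d i\<close>, and
          \<open>h\<close>, \<open>k\<close> are nonnegative, so \<open>d i\<close> factors out.
          This is where the sum of the two constants comes from.\<close>
        show "\<forall>\<^sub>F i in sequentially \<times>\<^sub>F sequentially.
          \<bar>renyi_sym r \<alpha> (u i) (v i) - renyi_sym r \<alpha> p q\<bar> \<le> d i * (h i + k i)"
          using le
        proof eventually_elim
          case (elim i)
          also have "sup_dev r (u i) p * h i + sup_dev r (v i) q * k i \<le> d i * h i + d i * k i"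
            unfolding d_def using hk(3,4) by (intro add_mono mult_right_mono) auto
          finally show ?case
            by (simp add: distrib_left)
        qed
      qed (use hk(3,4) r in \<open>simp_all add: d_def prod_filter_eq_bot sup_dev_nonneg max.coboundedI1\<close>)
      then show ?case
        by (simp add: u_def v_def d_def case_prod_unfold)
    qed
  qed
qed

end
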